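(* For every integer $j\ge0$, the following identity of rational functions of $x$ holds: $$\sum_{i=0}^{2j+1}\binom{x-1}{i}\,\overline{\sigma}_{2j+1-i}(x-i)=0.$$
   Context: Binomial coefficients are $\binom{y}{i}=y(y-1)\cdots(y-i+1)/i!$, and $x^{\underline{k+1}}=x(x-1)\cdots(x-k)$. Let $s(n,m)=(-2)^{n-m}c(n,m)$ with $c(n,m)$ the unsigned Stirling numbers of the first kind. For each fixed integer $k\ge0$, $s(n,n-k)$, for integers $n\ge k$, is the value at $x=n$ of a unique polynomial in $x$, denoted $s(x,x-k)$. The (scaled) Stirling polynomials are $\overline{\sigma}_k(x)=s(x,x-k)/x^{\underline{k+1}}$ (a polynomial for $k\ge1$, and $\overline{\sigma}_0(x)=1/x$). *)

theory Defs
  imports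
    "HOL-Combinatorics.Stirling"
    "HOL-Computational_Algebra.Computational_Algebra"
    "HOL-Computational_Algebra.Field_as_Ring"
begin

text \<open>The library constant \<^const>\<open>stirling\<close> is the unsigned Stirling number of the first kind.
  The truncated subtraction is harmless: \<open>stirling n m = 0\<close> for \<open>m > n\<close>.\<close>

definition scaled_stirling :: "nat \<Rightarrow> nat \<Rightarrow> rat" where
  "scaled_stirling n m = (-2) ^ (n - m) * of_nat (stirling n m)"

definition stirling_diag_poly :: "nat \<Rightarrow> rat poly" where
  "stirling_diag_poly k =
     (THE p. \<forall>n\<ge>k. poly p (of_nat n) = scaled_stirling n (n - k))"

definition falling_poly :: "nat \<Rightarrow> rat poly" where
  "falling_poly m = (\<Prod>i<m. [:- of_nat i, 1:])"

text \<open>Rational functions of \<open>x\<close> over the rationals are elements of the fraction field of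
  the polynomial ring, with \<open>x\<close> the polynomial \<open>[:0, 1:]\<close>.\<close>

definition stirling_rat :: "nat \<Rightarrow> rat poly fract" where
  "stirling_rat k =
     to_fract (stirling_diag_poly k) / to_fract (falling_poly (Suc k))"

text \<open>\<open>fract_shift c f\<close> is the rational function \<open>f(x - c)\<close>.  It is computed on the library's normalised
  numerator and denominator; by \<open>fract_shift_Fract\<close> any other representation gives the same result.\<close>

definition fract_shift :: "rat \<Rightarrow> rat poly fract \<Rightarrow> rat poly fract" where
  "fract_shift c f = (case quot_of_fract f of (p, q) \<Rightarrow>
     Fract (pcompose p [:- c, 1:]) (pcompose q [:- c, 1:]))"

lemma fract_shift_Fract:
  assumes "q \<noteq> 0"
  shows "fract_shift c (Fract p q) = Fract (pcompose p [:- c, 1:]) (pcompose q [:- c, 1:])"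
proof -
  obtain a b where ab: "quot_of_fract (Fract p q) = (a, b)" by fastforce
  then have b: "b \<noteq> 0" by (metis snd_conv snd_quot_of_fract_nonzero)
  have "Fract a b = Fract p q"
    using quot_to_fract_quot_of_fract[of "Fract p q"] ab by (simp add: quot_to_fract_def)
  then have "a * q = p * b" using assms b by (simp add: eq_fract)
  then have "pcompose a [:- c, 1:] * pcompose q [:- c, 1:]
      = pcompose p [:- c, 1:] * pcompose b [:- c, 1:]"
    by (simp flip: pcompose_mult)
  moreover have "pcompose q [:- c, 1:] \<noteq> 0" "pcompose b [:- c, 1:] \<noteq> 0"
    using assms b by (auto dest!: pcompose_eq_0)
  ultimately show ?thesis by (simp add: fract_shift_def ab eq_fract)
qed

end

theory Submission
  imports Defs
begin

text \<open>
  Let \<open>F = 2 z / (exp (2 z) - 1)\<close>. The scaled Stirling polynomials have the generating function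
  \<open>x * (\<Sum>k. \<sigma>\<^sub>k(x) z^k) = F^x\<close>. Here a power of a series with constant term \<open>1\<close> has coefficients
  that are polynomials in the exponent \<open>x\<close> (\<open>power_coeff_poly\<close>), so \<open>\<sigma>\<^sub>k(x)\<close> is such a polynomial
  divided by \<open>x\<close> (\<open>stirling_rat_eq\<close>). For natural exponents this generating function follows
  from the differential equation \<open>z F' = F - F\<^sup>2 - 2 z F\<close>, which turns into the recurrence of the
  Stirling numbers (\<open>scaled_stirling_eq_bernoulli_fps_power\<close>).

  Since \<open>(x - 1 choose i) / (x - i) = (x choose i) / x\<close>, the \<open>i\<close>-th summand of the identity is \<open>1 / x\<close>
  times \<open>(x choose i)\<close> times the coefficient of \<open>z^(m - i)\<close> in \<open>F^(x - i)\<close>, where \<open>m = 2 j + 1\<close>.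
  By the binomial theorem the sum is \<open>1 / x\<close> times the coefficient of \<open>z^m\<close> in \<open>(F + z)^x\<close>. But
  \<open>F + z = z * coth z\<close> is an even series (\<open>bernoulli_fps_plus_X_even\<close>), and \<open>m\<close> is odd, so this
  coefficient is \<open>0\<close>. The binomial theorem is applied at natural exponents \<open>x \<ge> m\<close>, which suffices because
  the expression is polynomial in \<open>x\<close> (\<open>binomial_convolution_eq_0\<close>).
\<close>

section \<open>Powers of a power series as polynomials in the exponent\<close>

definition binomial_poly :: "nat \<Rightarrow> 'a::field_char_0 poly" where
  "binomial_poly i = smult (1 / fact i) (\<Prod>j<i. [:- of_nat j, 1:])"

lemma poly_binomial_poly: "poly (binomial_poly i) a = a gchoose i"
  by (simp add: binomial_poly_def poly_prod gbinomial_prod_rev lessThan_atLeast0)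

text \<open>The coefficient of \<open>z^k\<close> in \<open>A^x = (\<Sum>i. (x choose i) * (A - 1)^i)\<close>, as a polynomial in \<open>x\<close>. If \<open>A\<close>
  has constant term \<open>1\<close>, then \<open>(A - 1)^i\<close> starts at \<open>z^i\<close>, hence the bound \<open>i \<le> k\<close>.\<close>

definition power_coeff_poly :: "'a::field_char_0 fps \<Rightarrow> nat \<Rightarrow> 'a poly" where
  "power_coeff_poly A k = (\<Sum>i\<le>k. smult (fps_nth ((A - 1) ^ i) k) (binomial_poly i))"

lemma poly_power_coeff_poly:
  fixes A :: "'a::field_char_0 fps"
  assumes "fps_nth A 0 = 1"
  shows "poly (power_coeff_poly A k) (of_nat n) = fps_nth (A ^ n) k"
proof -
  have vanish: "fps_nth ((A - 1) ^ i) k = 0" if "i > k" for i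
    using assms that by (intro startsby_zero_power_prefix[rule_format]) auto
  have "A ^ n = ((A - 1) + 1) ^ n" by simp
  also have "\<dots> = (\<Sum>i\<le>n. of_nat (n choose i) * (A - 1) ^ i)"
    by (subst binomial_ring) simp
  finally have "fps_nth (A ^ n) k = (\<Sum>i\<le>n. of_nat (n choose i) * fps_nth ((A - 1) ^ i) k)"
    by (simp add: fps_sum_nth fps_of_nat [symmetric] del: fps_of_nat)
  also have "\<dots> = (\<Sum>i\<in>{..n} \<union> {..k}. of_nat (n choose i) * fps_nth ((A - 1) ^ i) k)"
    by (intro sum.mono_neutral_left) (auto simp: binomial_eq_0)
  also have "\<dots> = (\<Sum>i\<le>k. of_nat (n choose i) * fps_nth ((A - 1) ^ i) k)"
    by (intro sum.mono_neutral_right) (auto simp: vanish)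
  finally show ?thesis
    by (simp add: power_coeff_poly_def poly_sum poly_binomial_poly binomial_gbinomial mult.commute)
qed

lemma poly_eqI_of_nat:
  fixes p q :: "'a::field_char_0 poly"
  assumes "\<And>n. n \<ge> N \<Longrightarrow> poly p (of_nat n) = poly q (of_nat n)"
  shows "p = q"
proof (rule ccontr)
  assume "p \<noteq> q"
  then have "finite {x. poly (p - q) x = 0}" by (intro poly_roots_finite) simp
  moreover have "of_nat ` {N..} \<subseteq> {x. poly (p - q) x = 0}" using assms by auto
  ultimately have "finite (of_nat ` {N..} :: 'a set)" using finite_subset by blast
  then have "finite {N..}" by (rule finite_imageD) (simp add: inj_on_def)
  then show False by (simp add: infinite_Ici)
qed

section \<open>The generating function\<close>

text \<open>The series \<open>2 z / (exp (2 z) - 1)\<close>. Division by \<open>z\<close> is carried out on the coefficients of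
  \<open>exp (2 z) - 1\<close>, so that the inverted series has constant term \<open>1\<close>.\<close>

definition bernoulli_fps :: "rat fps" where
  "bernoulli_fps = inverse (Abs_fps (\<lambda>n. 2 ^ n / fact (Suc n)))"

lemma bernoulli_fps_nth_0 [simp]: "fps_nth bernoulli_fps 0 = 1"
  by (simp add: bernoulli_fps_def)

lemma bernoulli_fps_mult: "bernoulli_fps * (fps_exp 2 - 1) = 2 * fps_X"
proof -
  let ?U = "Abs_fps (\<lambda>n. 2 ^ n / fact (Suc n)) :: rat fps"
  have "fps_exp 2 - 1 = 2 * fps_X * ?U"
  proof (rule fps_ext)
    fix n show "fps_nth (fps_exp 2 - 1) n = fps_nth (2 * fps_X * ?U) n"
      by (cases n) (simp_all add: numeral_fps_const algebra_simps)
  qed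
  moreover have "bernoulli_fps * ?U = 1"
    unfolding bernoulli_fps_def by (rule inverse_mult_eq_1) simp
  ultimately show ?thesis by (simp add: algebra_simps)
qed

text \<open>Differentiating \<open>F * (exp (2 z) - 1) = 2 z\<close> leaves the exponential in the equation; it is
  eliminated with the same relation, in the form \<open>F * exp (2 z) = F + 2 z\<close>.\<close>

lemma bernoulli_fps_deriv:
  "fps_X * fps_deriv bernoulli_fps = bernoulli_fps - bernoulli_fps\<^sup>2 - 2 * fps_X * bernoulli_fps"
proof -
  let ?F = bernoulli_fps and ?e = "fps_exp 2 :: rat fps"
  have two: "fps_const 2 = (2 :: rat fps)" by (simp add: numeral_fps_const)
  have Fe: "?F * ?e = ?F + 2 * fps_X" using bernoulli_fps_mult by (simp add: algebra_simps)
  have d2: "fps_deriv (2 :: rat fps) = 0" by (simp add: numeral_fps_const)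
  have "fps_deriv (?F * (?e - 1)) = fps_deriv (2 * fps_X)" by (simp only: bernoulli_fps_mult)
  then have d: "fps_deriv ?F * (?e - 1) = 2 - 2 * (?F * ?e)"
    by (simp add: two d2 algebra_simps)
  have "2 * (fps_X * fps_deriv ?F) = fps_deriv ?F * (?F * (?e - 1))"
    by (simp add: bernoulli_fps_mult)
  also have "\<dots> = ?F * (2 - 2 * (?F * ?e))"
    by (simp only: mult.left_commute[of _ ?F] d)
  also have "\<dots> = 2 * (?F - ?F\<^sup>2 - 2 * fps_X * ?F)"
    unfolding Fe by (simp add: algebra_simps power2_eq_square)
  finally show ?thesis
    by (subst (asm) mult_cancel_left) (simp add: numeral_fps_const)
qed

text \<open>The coefficients of the differential equation for \<open>F^n\<close>, obtained by multiplying the one for \<open>F\<close>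
  by \<open>n * F^(n - 1)\<close>. Up to the factor \<open>(n - 1) \<cdots> (n - k)\<close> this is the recurrence of the
  Stirling numbers.\<close>

lemma bernoulli_fps_power_rec:
  "of_nat n * fps_nth (bernoulli_fps ^ Suc n) (Suc k) =
     (of_nat n - of_nat (Suc k)) * fps_nth (bernoulli_fps ^ n) (Suc k)
     - 2 * of_nat n * fps_nth (bernoulli_fps ^ n) k"
proof -
  let ?F = bernoulli_fps
  have "fps_X * fps_deriv (?F ^ n) = of_nat n * (?F ^ n - ?F ^ Suc n - 2 * fps_X * ?F ^ n)"
  proof (cases n)
    case (Suc m)
    have "fps_X * fps_deriv (?F ^ n) = of_nat n * ?F ^ m * (fps_X * fps_deriv ?F)"
      by (subst fps_deriv_power) (simp add: Suc fps_of_nat algebra_simps del: of_nat_Suc)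
    then show ?thesis
      unfolding bernoulli_fps_deriv by (simp add: Suc algebra_simps power2_eq_square)
  qed simp
  from arg_cong[OF this, of "\<lambda>f. fps_nth f (Suc k)"]
  show ?thesis
    by (simp add: fps_of_nat[symmetric] numeral_fps_const algebra_simps del: fps_of_nat power_Suc)
qed

text \<open>Both sides satisfy the same recurrence in \<open>n\<close>. The product is not divided out, so that the case
  \<open>k = n\<close> is covered: for \<open>k = n > 0\<close> it vanishes, as does the Stirling number.\<close>

lemma scaled_stirling_eq_bernoulli_fps_power:
  assumes "k \<le> n"
  shows "(\<Prod>i=1..k. of_nat n - of_nat i) * fps_nth (bernoulli_fps ^ n) k = scaled_stirling n (n - k)"
  using assms
proof (induction n arbitrary: k)
  case 0
  then show ?case by (simp add: scaled_stirling_def)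
next
  case (Suc n)
  consider "k = 0" | "k = Suc n" | l where "k = Suc l" "k \<le> n"
    using Suc.prems by (cases k) (auto simp: le_Suc_eq)
  then show ?case
  proof cases
    case 1
    then show ?thesis by (simp add: scaled_stirling_def fps_nth_power_0)
  next
    case 2
    then show ?thesis by (simp add: scaled_stirling_def)
  next
    case 3
    define w :: "nat \<Rightarrow> rat" where "w r = (\<Prod>i=1..r. of_nat n - of_nat i)" for r
    have IH: "w k * fps_nth (bernoulli_fps ^ n) k = scaled_stirling n (n - k)"
        "w l * fps_nth (bernoulli_fps ^ n) l = scaled_stirling n (n - l)"
      using Suc.IH[of k] Suc.IH[of l] 3 by (simp_all add: w_def)
    have w: "w k = w l * (of_nat n - of_nat k)" by (simp add: 3 w_def)
    have "(\<Prod>i=1..k. of_nat (Suc n) - of_nat i :: rat) = (\<Prod>i=0..l. of_nat n - of_nat i)"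
      unfolding 3 using prod.shift_bounds_cl_Suc_ivl[of "\<lambda>i. of_nat (Suc n) - of_nat i :: rat" 0 l]
      by simp
    also have "\<dots> = of_nat n * w l"
      by (subst prod.atLeast_Suc_atMost) (simp_all add: w_def)
    finally have "(\<Prod>i=1..k. of_nat (Suc n) - of_nat i) * fps_nth (bernoulli_fps ^ Suc n) k =
        w l * (of_nat n * fps_nth (bernoulli_fps ^ Suc n) k)" by simp
    also have "\<dots> = w l * ((of_nat n - of_nat k) * fps_nth (bernoulli_fps ^ n) k
        - 2 * of_nat n * fps_nth (bernoulli_fps ^ n) l)"
      unfolding 3(1) by (simp only: bernoulli_fps_power_rec)
    also have "\<dots> = scaled_stirling n (n - k) - 2 * of_nat n * scaled_stirling n (n - l)"
      unfolding IH[symmetric] w by (simp add: algebra_simps)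
    also have "\<dots> = scaled_stirling (Suc n) (Suc n - k)"
    proof -
      have "n - l = Suc (n - k)" "Suc n - k = Suc (n - k)" "n - (n - k) = Suc l"
          "n - Suc (n - k) = l" "Suc n - Suc (n - k) = Suc l"
        using 3 by auto
      then show ?thesis by (simp add: scaled_stirling_def algebra_simps)
    qed
    finally show ?thesis .
  qed
qed

section \<open>The Stirling polynomials\<close>

text \<open>The product on the right has the values required of \<open>s(x, x - k)\<close> at all \<open>n \<ge> k\<close>, and a polynomial
  is determined by these.\<close>

lemma stirling_diag_poly_eq:
  "stirling_diag_poly k = (\<Prod>i=1..k. [:- of_nat i, 1:]) * power_coeff_poly bernoulli_fps k"
  (is "_ = ?D")
proof -
  have *: "poly ?D (of_nat n) = scaled_stirling n (n - k)" if "n \<ge> k" for n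
    using scaled_stirling_eq_bernoulli_fps_power[OF that]
    by (simp add: poly_prod poly_power_coeff_poly)
  show ?thesis
    unfolding stirling_diag_poly_def
  proof (rule the_equality)
    fix p assume "\<forall>n\<ge>k. poly p (of_nat n) = scaled_stirling n (n - k)"
    with * show "p = ?D" by (intro poly_eqI_of_nat[of k]) auto
  qed (use * in auto)
qed

text \<open>The product \<open>(x - 1) \<cdots> (x - k)\<close> cancels against the denominator and leaves only \<open>x\<close>.\<close>

lemma stirling_rat_eq: "stirling_rat k = Fract (power_coeff_poly bernoulli_fps k) [:0, 1:]"
proof -
  let ?W = "\<Prod>i=1..k. [:- of_nat i, 1:] :: rat poly"
  have "?W \<noteq> 0" by simp
  have "falling_poly (Suc k) = (\<Prod>i=0..k. [:- of_nat i, 1:])"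
    unfolding falling_poly_def by (simp add: lessThan_Suc_atMost atMost_atLeast0)
  also have "\<dots> = [:0, 1:] * ?W"
    by (subst prod.atLeast_Suc_atMost) simp_all
  finally have "falling_poly (Suc k) = [:0, 1:] * ?W" .
  then show ?thesis
    using \<open>?W \<noteq> 0\<close>
    by (simp add: stirling_rat_def stirling_diag_poly_eq Fract_conv_to_fract del: mult_pCons_left)
qed

section \<open>Parity of z coth z\<close>

text \<open>This series is \<open>z * coth z\<close>. The proof substitutes \<open>-z\<close> in \<open>F * (exp (2 z) - 1) = 2 z\<close> and
  multiplies by \<open>exp (2 z)\<close>, which gives \<open>F(-z) = F(z) + 2 z\<close>.\<close>

lemma bernoulli_fps_plus_X_even:
  "fps_compose (bernoulli_fps + fps_X) (- fps_X) = bernoulli_fps + fps_X"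
proof -
  let ?F = bernoulli_fps and ?e = "fps_exp 2 :: rat fps" and ?G = "fps_compose bernoulli_fps (- fps_X)"
  have X0: "fps_nth (- fps_X :: rat fps) 0 = 0" by simp
  have "fps_compose (?F * (?e - 1)) (- fps_X) = fps_compose (2 * fps_X) (- fps_X)"
    by (simp only: bernoulli_fps_mult)
  then have "?G * (fps_exp (-2) - 1) = - 2 * fps_X"
    by (simp add: fps_compose_mult_distrib[OF X0] fps_compose_sub_distrib numeral_fps_const)
  moreover have "fps_exp (-2) * ?e = 1"
    by (simp flip: fps_exp_add_mult)
  ultimately have "?G * (?e - 1) = 2 * fps_X * ?e"
    by algebra
  also have "\<dots> = (?F + 2 * fps_X) * (?e - 1)"
    using bernoulli_fps_mult by (simp add: algebra_simps)
  finally have "?G = ?F + 2 * fps_X"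
  proof (subst (asm) mult_right_cancel)
    show "?e - 1 \<noteq> 0" by (auto simp: fps_eq_iff intro: exI[of _ 1])
  qed
  then show ?thesis by (simp add: fps_compose_add_distrib)
qed

lemma odd_coeff_bernoulli_fps_plus_X_power:
  assumes "odd m"
  shows "fps_nth ((bernoulli_fps + fps_X) ^ n) m = 0"
proof -
  let ?H = "(bernoulli_fps + fps_X) ^ n"
  have "fps_compose ?H (- fps_X) = ?H"
    by (simp add: bernoulli_fps_plus_X_even flip: fps_compose_power)
  then have "fps_nth ?H m = fps_nth (fps_compose ?H (- fps_X)) m" by simp
  also have "\<dots> = - fps_nth ?H m" using assms by (simp add: fps_compose_uminus')
  finally show ?thesis by simp
qed

text \<open>At a natural number \<open>n \<ge> m\<close> the sum is the binomial expansion of the coefficient of \<open>z^m\<close> in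
  \<open>(z + F)^n\<close>. The restriction \<open>n \<ge> m\<close> makes every \<open>n - i\<close> a natural exponent.\<close>

lemma binomial_convolution_eq_0:
  assumes "odd m"
  shows "(\<Sum>i\<le>m. binomial_poly i * pcompose (power_coeff_poly bernoulli_fps (m - i)) [:- of_nat i, 1:]) = 0"
    (is "?Q = 0")
proof (rule poly_eqI_of_nat[of m])
  fix n assume n: "m \<le> n"
  let ?F = bernoulli_fps
  have "poly ?Q (of_nat n) = (\<Sum>i\<le>m. of_nat (n choose i) * fps_nth (?F ^ (n - i)) (m - i))"
    unfolding poly_sum
  proof (rule sum.cong)
    fix i assume "i \<in> {..m}"
    with n have "of_nat n - of_nat i = (of_nat (n - i) :: rat)" by simp
    then have "poly (power_coeff_poly ?F (m - i)) (of_nat n - of_nat i) = fps_nth (?F ^ (n - i)) (m - i)"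
      by (simp only: poly_power_coeff_poly bernoulli_fps_nth_0)
    then show "poly (binomial_poly i * pcompose (power_coeff_poly ?F (m - i)) [:- of_nat i, 1:]) (of_nat n)
        = of_nat (n choose i) * fps_nth (?F ^ (n - i)) (m - i)"
      by (simp add: poly_pcompose poly_binomial_poly binomial_gbinomial)
  qed simp
  also have "\<dots> = (\<Sum>i\<le>n. of_nat (n choose i) * fps_nth (fps_X ^ i * ?F ^ (n - i)) m)"
    using n by (intro sum.mono_neutral_cong_left) (auto simp: fps_X_power_mult_nth)
  also have "\<dots> = fps_nth ((fps_X + ?F) ^ n) m"
    by (subst binomial_ring) (simp add: fps_sum_nth mult.assoc fps_of_nat [symmetric] del: fps_of_nat)
  also have "\<dots> = 0"
    using odd_coeff_bernoulli_fps_plus_X_power[OF assms] by (simp add: add.commute)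
  finally show "poly ?Q (of_nat n) = poly 0 (of_nat n)" by simp
qed

section \<open>The identity\<close>

lemma to_fract_of_nat: "to_fract (of_nat n) = of_nat n"
  by (induction n) simp_all

lemma to_fract_prod: "to_fract (\<Prod>i\<in>A. f i) = (\<Prod>i\<in>A. to_fract (f i))"
  by (induction A rule: infinite_finite_induct) simp_all

lemma to_fract_binomial_poly:
  "to_fract (binomial_poly i :: rat poly) = (to_fract [:0, 1:] gchoose i)"
proof -
  have "(fact i :: rat poly) = [:fact i:]"
    using of_nat_poly[of "fact i", where ?'a = rat] by (simp only: of_nat_fact)
  then have "fact i * binomial_poly i = (\<Prod>j<i. [:- of_nat j, 1:] :: rat poly)"
    by (simp add: binomial_poly_def)
  also have "\<dots> = (\<Prod>j<i. [:0, 1:] - of_nat j)"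
    by (intro prod.cong) (simp_all add: of_nat_poly)
  finally have "to_fract (fact i * binomial_poly i) = to_fract (\<Prod>j<i. [:0, 1:] - of_nat j :: rat poly)"
    by simp
  moreover have "to_fract (fact i :: rat poly) = fact i"
    using to_fract_of_nat[of "fact i", where ?'a = "rat poly"] by (simp only: of_nat_fact)
  ultimately have "fact i * to_fract (binomial_poly i :: rat poly) = (\<Prod>j<i. to_fract [:0, 1:] - of_nat j)"
    by (simp add: to_fract_prod to_fract_of_nat)
  then show ?thesis
    by (simp add: gbinomial_prod_rev lessThan_atLeast0 field_simps)
qed

theorem mainTheorem10:
  fixes j :: nat
  shows "(\<Sum>i = 0..2 * j + 1.
      ((to_fract [:0, 1:] - 1) gchoose i) * fract_shift (of_nat i) (stirling_rat (2 * j + 1 - i))) = 0"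
proof -
  define m where "m = 2 * j + 1"
  define x :: "rat poly fract" where "x = to_fract [:0, 1:]"
  define T where "T i = binomial_poly i * pcompose (power_coeff_poly bernoulli_fps (m - i)) [:- of_nat i, 1:]" for i
  have "x \<noteq> 0" by (simp add: x_def)
  have summand: "((x - 1) gchoose i) * fract_shift (of_nat i) (stirling_rat (m - i)) = to_fract (T i) / x" for i
  proof -
    have lin: "to_fract [:- of_nat i, 1:] = x - of_nat i"
    proof -
      have "[:- of_nat i, 1:] = [:0, 1:] - (of_nat i :: rat poly)" by (simp add: of_nat_poly)
      then show ?thesis by (simp add: x_def to_fract_of_nat)
    qed
    have "to_fract [:- of_nat i, 1:] \<noteq> (0 :: rat poly fract)" by simp
    then have "x - of_nat i \<noteq> 0" unfolding lin .
    moreover have "fract_shift (of_nat i) (stirling_rat (m - i)) =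
        to_fract (pcompose (power_coeff_poly bernoulli_fps (m - i)) [:- of_nat i, 1:]) / (x - of_nat i)"
      by (simp add: stirling_rat_eq fract_shift_Fract pcompose_pCons flip: lin) (simp add: to_fract_def)
    moreover have "(x - 1) gchoose i = (x - of_nat i) * (x gchoose i) / x"
      using gbinomial_absorb_comp[of x i] \<open>x \<noteq> 0\<close> by simp
    ultimately show ?thesis
      by (simp add: T_def to_fract_binomial_poly flip: x_def)
  qed
  have "(\<Sum>i=0..m. ((x - 1) gchoose i) * fract_shift (of_nat i) (stirling_rat (m - i))) =
      to_fract (\<Sum>i\<le>m. T i) / x"
    unfolding summand by (simp add: to_fract_sum sum_divide_distrib atMost_atLeast0)
  also have "(\<Sum>i\<le>m. T i) = 0"
    unfolding T_def by (rule binomial_convolution_eq_0) (simp add: m_def)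
  finally show ?thesis by (simp add: m_def x_def)
qed

end
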